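(* Let $\Gamma_1,\Gamma_2$ be nonzero real vorticities. Every trajectory of the system of two point vortices on the hyperbolic plane is an $SL(2,\mathbb{R})$-stable relative equilibrium; that is, every point $X_e=(X_1,X_2)\in\mathcal M$ is a relative equilibrium and is $SL(2,\mathbb{R})$-stable.
   Context: On $\mathbb{R}^3$ let $\langle X_1,X_2\rangle_{\mathcal H}=x_1x_2+y_1y_2-z_1z_2$ and $X_1\times_{\mathcal H}X_2=(y_1z_2-z_1y_2,\ z_1x_2-x_1z_2,\ -x_1y_2+y_1x_2)$. The hyperbolic plane is $\mathcal H_2=\{(x,y,z)\in\mathbb{R}^3\mid z^2-x^2-y^2=1,\ z>0\}$. The phase space is $\mathcal M=\{(X_1,X_2)\in\mathcal H_2\times\mathcal H_2\mid X_1\ne X_2\}$. The dynamics is $$\dot X_r=\frac1\pi\sum_{p\ne r}\Gamma_p\frac{X_p\times_{\mathcal H}X_r}{\langle X_r,X_p\rangle_{\mathcal H}^2-1},\qquad r=1,2.$$ The group $SL(2,\mathbb{R})$ acts on $\mathbb{R}^3$ by conjugation $\rho\mapsto g\rho g^{-1}$ under the identification $(x,y,z)\leftrightarrow\begin{pmatrix} x & y+z \\ y-z & -x \end{pmatrix}$; this preserves $\mathcal H_2$ and acts diagonally on $\mathcal M$. A point $X_e\in\mathcal M$ is a relative equilibrium if the trajectory through $X_e$ is contained in the $SL(2,\mathbb{R})$-orbit of $X_e$. For a subgroup $G'\subseteq SL(2,\mathbb{R})$, a relative equilibrium $X_e$ is $G'$-stable if for every $G'$-invariant open neighbourhood $V$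 of $X_e$ there is a $G'$-invariant open neighbourhood $U$ of $X_e$ such that every trajectory intersecting $U$ lies entirely within $V$. *)

theory Defs
  imports "HOL-Analysis.Analysis"
begin

definition hinner :: "real^3 \<Rightarrow> real^3 \<Rightarrow> real" where
  "hinner u v = u$1 * v$1 + u$2 * v$2 - u$3 * v$3"

definition hcross :: "real^3 \<Rightarrow> real^3 \<Rightarrow> real^3" where
  "hcross u v = vector [u$2 * v$3 - u$3 * v$2,
                        u$3 * v$1 - u$1 * v$3,
                        - (u$1 * v$2) + u$2 * v$1]"

definition hyp_plane :: "(real^3) set" where
  "hyp_plane = {v. (v$3)^2 - (v$1)^2 - (v$2)^2 = 1 \<and> v$3 > 0}"

text \<open>A configuration \<open>(X\<^sub>1, X\<^sub>2)\<close> is an element of \<^typ>\<open>real^3^2\<close>,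
  so that the two vortices are indexed by the two-element type \<open>2\<close>.\<close>

definition phase_space :: "(real^3^2) set" where
  "phase_space = {X. X$1 \<in> hyp_plane \<and> X$2 \<in> hyp_plane \<and> X$1 \<noteq> X$2}"

definition vortex_field :: "real^2 \<Rightarrow> real^3^2 \<Rightarrow> real^3^2" where
  "vortex_field \<Gamma> X = (\<chi> r. (1 / pi) *\<^sub>R
     (\<Sum>p \<in> UNIV - {r}. (\<Gamma>$p / ((hinner (X$r) (X$p))^2 - 1)) *\<^sub>R hcross (X$p) (X$r)))"

definition solution_on :: "real^2 \<Rightarrow> real set \<Rightarrow> (real \<Rightarrow> real^3^2) \<Rightarrow> bool" where
  "solution_on \<Gamma> I x \<longleftrightarrow> open I \<and> is_interval I \<and>
     (\<forall>t\<in>I. x t \<in> phase_space \<and>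
            (x has_vector_derivative vortex_field \<Gamma> (x t)) (at t))"

text \<open>The union of the images of all solutions with initial value \<open>X\<close>. The vector field is
  smooth on the phase space, so solutions agree on common intervals and this is the image of the
  maximal integral curve (for all positive and negative times at which it exists).\<close>

definition trajectory :: "real^2 \<Rightarrow> real^3^2 \<Rightarrow> (real^3^2) set" where
  "trajectory \<Gamma> X = {x t | x I t. solution_on \<Gamma> I x \<and> 0 \<in> I \<and> x 0 = X \<and> t \<in> I}"

definition SL2 :: "(real^2^2) set" where
  "SL2 = {g. det g = 1}"

definition to_mat :: "real^3 \<Rightarrow> real^2^2" where
  "to_mat v = vector [vector [v$1, v$2 + v$3], vector [v$2 - v$3, - (v$1)]]"

text \<open>The inverse of \<^const>\<open>to_mat\<close> on the trace-free matrices, which are preserved by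
  conjugation; see the lemmas \<open>of_mat_to_mat\<close> and \<open>to_mat_act\<close> below.\<close>

definition of_mat :: "real^2^2 \<Rightarrow> real^3" where
  "of_mat A = vector [A$1$1, (A$1$2 + A$2$1) / 2, (A$1$2 - A$2$1) / 2]"

definition act :: "real^2^2 \<Rightarrow> real^3 \<Rightarrow> real^3" where
  "act g v = of_mat (g ** to_mat v ** matrix_inv g)"

definition act_diag :: "real^2^2 \<Rightarrow> real^3^2 \<Rightarrow> real^3^2" where
  "act_diag g X = (\<chi> r. act g (X$r))"

definition group_orbit :: "(real^2^2) set \<Rightarrow> real^3^2 \<Rightarrow> (real^3^2) set" where
  "group_orbit G X = {act_diag g X | g. g \<in> G}"

definition invariant_nbhd :: "(real^2^2) set \<Rightarrow> real^3^2 \<Rightarrow> (real^3^2) set \<Rightarrow> bool" where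
  "invariant_nbhd G X V \<longleftrightarrow> openin (top_of_set phase_space) V \<and> X \<in> V \<and>
     (\<forall>g\<in>G. \<forall>Y\<in>V. act_diag g Y \<in> V)"

definition relative_equilibrium :: "real^2 \<Rightarrow> real^3^2 \<Rightarrow> bool" where
  "relative_equilibrium \<Gamma> X \<longleftrightarrow>
     X \<in> phase_space \<and> trajectory \<Gamma> X \<subseteq> group_orbit SL2 X"

definition group_stable :: "(real^2^2) set \<Rightarrow> real^2 \<Rightarrow> real^3^2 \<Rightarrow> bool" where
  "group_stable G \<Gamma> X \<longleftrightarrow>
     (\<forall>V. invariant_nbhd G X V \<longrightarrow>
        (\<exists>U. invariant_nbhd G X U \<and>
           (\<forall>Y\<in>phase_space. trajectory \<Gamma> Y \<inter> U \<noteq> {} \<longrightarrow> trajectory \<Gamma> Y \<subseteq> V)))"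

lemma of_mat_to_mat: "of_mat (to_mat v) = v"
  by (simp add: of_mat_def to_mat_def vec_eq_iff forall_3 field_simps)

lemma to_mat_of_mat:
  assumes "trace A = 0"
  shows "to_mat (of_mat A) = A"
  using assms
  by (simp add: of_mat_def to_mat_def trace_def sum_2 vec_eq_iff forall_2 field_simps)

lemma to_mat_act:
  assumes "g \<in> SL2"
  shows "to_mat (act g v) = g ** to_mat v ** matrix_inv g"
proof -
  have "invertible g"
    using assms by (simp add: SL2_def invertible_det_nz)
  then have inv: "matrix_inv g ** g = mat 1"
    unfolding invertible_def matrix_inv_def by (rule someI2_ex) blast
  have "trace (g ** to_mat v ** matrix_inv g) = trace (matrix_inv g ** (g ** to_mat v))"
    by (rule trace_mul_sym)
  also have "\<dots> = trace (to_mat v)"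
    by (simp add: matrix_mul_assoc inv)
  also have "\<dots> = 0"
    by (simp add: trace_def sum_2 to_mat_def)
  finally show ?thesis
    unfolding act_def by (rule to_mat_of_mat)
qed

end

theory Submission imports Defs begin

text \<open>The quantity \<open>\<langle>X\<^sub>1, X\<^sub>2\<rangle>\<close> is conserved, because the velocity of each vortex is a multiple of
  \<open>X\<^sub>1 \<times> X\<^sub>2\<close> and hence orthogonal to both \<open>X\<^sub>1\<close> and \<open>X\<^sub>2\<close>. On the other hand \<open>SL(2,\<real>)\<close> acts
  transitively on the pairs of points with a given value of \<open>\<langle>X\<^sub>1, X\<^sub>2\<rangle>\<close>. So every trajectory stays
  in one group orbit, and every invariant neighbourhood that it meets contains it.\<close>

section \<open>The conjugation action and its invariant form\<close>

lemma SL2_mult: "g \<in> SL2 \<Longrightarrow> h \<in> SL2 \<Longrightarrow> g ** h \<in> SL2"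
  by (simp add: SL2_def det_mul)

lemma SL2_inverse:
  assumes "g \<in> SL2"
  shows "matrix_inv g ** g = mat 1" "g ** matrix_inv g = mat 1"
proof -
  have "invertible g"
    using assms by (simp add: SL2_def invertible_det_nz)
  then have "g ** matrix_inv g = mat 1 \<and> matrix_inv g ** g = mat 1"
    unfolding invertible_def matrix_inv_def by (rule someI_ex)
  then show "matrix_inv g ** g = mat 1" "g ** matrix_inv g = mat 1" by auto
qed

lemma matrix_inv_SL2:
  assumes "g \<in> SL2"
  shows "matrix_inv g \<in> SL2"
proof -
  have "det (matrix_inv g) * det g = 1"
    using SL2_inverse(1)[OF assms] by (metis det_I det_mul)
  with assms show ?thesis by (simp add: SL2_def)
qed

lemma to_mat_act_intertwine:
  assumes "g \<in> SL2"
  shows "to_mat (act g v) ** g = g ** to_mat v"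
  using assms by (simp add: to_mat_act SL2_inverse flip: matrix_mul_assoc)

text \<open>Conjugation in intertwining form: for an explicit \<open>g\<close> the premise is
  polynomial in the entries, so \<open>matrix_inv g\<close> never has to be computed.\<close>

lemma act_eqI:
  assumes "g \<in> SL2" and "g ** to_mat v = to_mat w ** g"
  shows "act g v = w"
  using assms by (simp add: act_def of_mat_to_mat SL2_inverse flip: matrix_mul_assoc)

lemma act_mult:
  assumes "g \<in> SL2" and "h \<in> SL2"
  shows "act (g ** h) v = act g (act h v)"
proof (rule act_eqI)
  show "g ** h \<in> SL2" using assms by (rule SL2_mult)
  show "g ** h ** to_mat v = to_mat (act g (act h v)) ** (g ** h)"
    using to_mat_act_intertwine[OF assms(1)] to_mat_act_intertwine[OF assms(2)]
    by (metis matrix_mul_assoc)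
qed

lemma act_matrix_inv:
  assumes "g \<in> SL2"
  shows "act (matrix_inv g) (act g v) = v"
proof (rule act_eqI)
  show "matrix_inv g \<in> SL2" using assms by (rule matrix_inv_SL2)
  show "matrix_inv g ** to_mat (act g v) = to_mat v ** matrix_inv g"
    using assms by (simp add: to_mat_act SL2_inverse matrix_mul_assoc)
qed

text \<open>The form is half the trace form, which makes its invariance under conjugation visible by
  cyclicity of the trace.\<close>

lemma hinner_eq_trace: "hinner u v = trace (to_mat u ** to_mat v) / 2"
  by (simp add: hinner_def trace_def to_mat_def matrix_matrix_mult_def sum_2 algebra_simps)

lemma hinner_act:
  assumes "g \<in> SL2"
  shows "hinner (act g u) (act g v) = hinner u v"
proof -
  have "to_mat (act g u) ** to_mat (act g v) = g ** (to_mat u ** to_mat v) ** matrix_inv g"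
    using to_mat_act_intertwine[OF assms, of u]
    by (simp add: to_mat_act[OF assms, of v] matrix_mul_assoc)
  then have "trace (to_mat (act g u) ** to_mat (act g v))
      = trace (matrix_inv g ** (g ** (to_mat u ** to_mat v)))"
    by (metis trace_mul_sym)
  then show ?thesis
    by (simp add: hinner_eq_trace matrix_mul_assoc SL2_inverse[OF assms])
qed

section \<open>Transitivity on pairs with equal inner product\<close>

text \<open>With \<open>J = to_mat (0,0,1)\<close> one has \<open>g J g\<^sup>-\<^sup>1 = g g\<^sup>T J\<close> for \<open>g \<in> SL2\<close>, so \<open>g\<close> is found as the
  Cholesky factor of the positive definite matrix \<open>to_mat v J\<^sup>-\<^sup>1\<close>.\<close>

lemma hyp_plane_from_base_point:
  assumes "v \<in> hyp_plane"
  obtains g where "g \<in> SL2" and "act g (vector [0, 0, 1]) = v"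
proof -
  \<comment> \<open>\<open>a\<close> squared is the upper left entry \<open>v$2 + v$3\<close> of the
    matrix to be factored.\<close>
  define a where "a = sqrt (v$2 + v$3)"
  have v: "(v$3)^2 - (v$1)^2 - (v$2)^2 = 1" "v$3 > 0"
    using assms by (auto simp: hyp_plane_def)
  have "(v$2)\<^sup>2 < (v$3)\<^sup>2"
    using v(1) zero_le_power2[of "v$1"] by linarith
  then have "\<bar>v$2\<bar> < v$3"
    using v(2) by (auto intro: power2_less_imp_less)
  then have "v$2 + v$3 > 0" using v by linarith
  then have a: "a > 0" "a * a = v$2 + v$3" by (auto simp: a_def)
  \<comment> \<open>Forced by \<open>det g = 1\<close>, as \<open>g\<close> is lower
    triangular.\<close>
  define b where "b = 1 / a"
  have ab: "a * b = 1" "(v$2 + v$3) * b = a"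
    using a by (simp_all add: b_def flip: a(2))
  define g :: "real^2^2" where "g = vector [vector [a, 0], vector [- (v$1) * b, b]]"
  have g: "g \<in> SL2"
    using ab by (simp add: SL2_def g_def det_2)
  \<comment> \<open>Prepares the lower left entry of \<open>g J = to_mat v g\<close>, from the
    equation of the hyperboloid.\<close>
  have "(v$3 - v$2) * a = ((v$3 - v$2) * (v$2 + v$3)) * b"
    by (simp flip: ab(2))
  also have "(v$3 - v$2) * (v$2 + v$3) = 1 + v$1 * v$1"
    using v(1) by (simp add: power2_eq_square algebra_simps)
  finally have "- b = v$1 * (v$1 * b) + (v$2 - v$3) * a"
    by (simp add: algebra_simps)
  moreover have "v$1 * a = (v$2 + v$3) * (v$1 * b)"
    by (simp flip: ab(2))
  ultimately have "g ** to_mat (vector [0, 0, 1]) = to_mat v ** g"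
    by (simp add: g_def to_mat_def matrix_matrix_mult_def vec_eq_iff forall_2 sum_2 ab(2))
  then show ?thesis using that g act_eqI by blast
qed

text \<open>The angle is halved since \<open>- mat 1\<close> acts trivially.\<close>

lemma act_rotation:
  fixes r t z :: real
  obtains g where "g \<in> SL2" and "act g (vector [0, 0, 1]) = vector [0, 0, 1]"
    and "act g (vector [r * cos t, r * sin t, z]) = vector [r, 0, z]"
proof -
  define c s where "c = cos (t/2)" and "s = sin (t/2)"
  define g :: "real^2^2" where "g = vector [vector [c, s], vector [- s, c]]"
  have cs: "c * c + s * s = 1"
    by (simp add: c_def s_def flip: power2_eq_square)
  have t: "cos t = c * c - s * s" "sin t = 2 * s * c"
    using cos_double[of "t/2"] sin_double[of "t/2"] by (simp_all add: c_def s_def power2_eq_square)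
  have g: "g \<in> SL2"
    using cs by (simp add: SL2_def g_def det_2)
  have "act g (vector [0, 0, 1]) = vector [0, 0, 1]"
    by (rule act_eqI[OF g])
      (simp add: g_def to_mat_def matrix_matrix_mult_def vec_eq_iff forall_2 sum_2)
  moreover have "act g (vector [r * cos t, r * sin t, z]) = vector [r, 0, z]"
  proof (rule act_eqI[OF g])
    \<comment> \<open>Expanded forms of cos(t - t/2) = cos(t/2) and sin(t - t/2) = sin(t/2).\<close>
    have "c * (c * c - s * s) + 2 * s * c * s = c * (c * c + s * s)"
      "2 * s * c * c - s * (c * c - s * s) = s * (c * c + s * s)"
      by (simp_all add: algebra_simps)
    then have "c * cos t + s * sin t = c" "c * sin t - s * cos t = s"
      unfolding t cs by (simp_all add: algebra_simps)
    then have "r * (c * cos t + s * sin t) = r * c" "r * (c * sin t - s * cos t) = r * s"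
      by simp_all
    then show "g ** to_mat (vector [r * cos t, r * sin t, z]) = to_mat (vector [r, 0, z]) ** g"
      by (simp add: g_def to_mat_def matrix_matrix_mult_def vec_eq_iff forall_2 sum_2
          algebra_simps)
  qed
  ultimately show ?thesis using that g by blast
qed

text \<open>Move \<open>u\<close> to the base point, then use the rotations fixing it to turn the
  other point into the half-plane y = 0, x \<ge> 0. The result depends on \<open>hinner u v\<close>
  alone.\<close>

lemma hyp_plane_pair_normal_form:
  assumes "u \<in> hyp_plane" and "v \<in> hyp_plane"
  obtains g where "g \<in> SL2" and "act g u = vector [0, 0, 1]"
    and "act g v = vector [sqrt ((hinner u v)\<^sup>2 - 1), 0, - hinner u v]"
proof -
  obtain k where k: "k \<in> SL2" "act k (vector [0, 0, 1]) = u"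
    using hyp_plane_from_base_point[OF assms(1)] .
  define l where "l = matrix_inv k"
  have l: "l \<in> SL2" "act l u = vector [0, 0, 1]"
    using matrix_inv_SL2[OF k(1)] act_matrix_inv[OF k(1), of "vector [0, 0, 1]"]
    by (auto simp: l_def k(2))
  define w where "w = act l v"
  define r where "r = sqrt ((hinner u v)\<^sup>2 - 1)"
  \<comment> \<open>Pairing with the base point reads off minus the third coordinate.\<close>
  have w3: "w$3 = - hinner u v"
    using hinner_act[OF l(1), of u v] by (simp add: l w_def hinner_def)
  have "hinner w w = -1"
    using hinner_act[OF l(1), of v v] assms(2)
    by (simp add: w_def hinner_def hyp_plane_def power2_eq_square)
  then have "(w$1)\<^sup>2 + (w$2)\<^sup>2 = (hinner u v)\<^sup>2 - 1"
    using w3 by (simp add: hinner_def[of w w] power2_eq_square)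
  \<comment> \<open>Polar coordinates for the first two entries of \<open>w\<close>, read as a
    complex number.\<close>
  then have "r = cmod (Complex (w$1) (w$2))"
    by (simp add: r_def cmod_def)
  then have "Complex (w$1) (w$2) = rcis r (Arg (Complex (w$1) (w$2)))"
    by (simp add: rcis_cmod_Arg)
  then obtain t where "w$1 = r * cos t" "w$2 = r * sin t"
    by (metis Re_rcis Im_rcis complex.sel)
  then have w: "w = vector [r * cos t, r * sin t, - hinner u v]"
    using w3 by (simp add: vec_eq_iff forall_3)
  obtain m where m: "m \<in> SL2" "act m (vector [0, 0, 1]) = vector [0, 0, 1]"
    "act m w = vector [r, 0, - hinner u v]"
    using act_rotation[where r = r and t = t and z = "- hinner u v"] w by metis
  show ?thesis
  proof
    show "m ** l \<in> SL2" using m l by (simp add: SL2_mult)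
    show "act (m ** l) u = vector [0, 0, 1]"
      using m l by (simp add: act_mult)
    show "act (m ** l) v = vector [sqrt ((hinner u v)\<^sup>2 - 1), 0, - hinner u v]"
      using m l by (simp add: act_mult flip: w_def r_def)
  qed
qed

text \<open>Both pairs reduce to the same normal form; one reduction followed by the inverse of the
  other links them.\<close>

lemma group_orbit_if_same_hinner:
  assumes "X \<in> phase_space" and "Y \<in> phase_space"
    and "hinner (X$1) (X$2) = hinner (Y$1) (Y$2)"
  shows "Y \<in> group_orbit SL2 X"
proof -
  have hyp: "X$1 \<in> hyp_plane" "X$2 \<in> hyp_plane" "Y$1 \<in> hyp_plane" "Y$2 \<in> hyp_plane"
    using assms(1,2) by (auto simp: phase_space_def)
  obtain g where g: "g \<in> SL2" "act g (X$1) = vector [0, 0, 1]"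
    "act g (X$2) = vector [sqrt ((hinner (X$1) (X$2))\<^sup>2 - 1), 0, - hinner (X$1) (X$2)]"
    using hyp_plane_pair_normal_form[OF hyp(1,2)] .
  obtain h where h: "h \<in> SL2" "act h (Y$1) = vector [0, 0, 1]"
    "act h (Y$2) = vector [sqrt ((hinner (Y$1) (Y$2))\<^sup>2 - 1), 0, - hinner (Y$1) (Y$2)]"
    using hyp_plane_pair_normal_form[OF hyp(3,4)] .
  have "act g (X$r) = act h (Y$r)" for r
    using exhaust_2[of r] g h assms(3) by auto
  then have "act (matrix_inv h ** g) (X$r) = Y$r" for r
    using g(1) h(1) by (simp add: act_mult act_matrix_inv matrix_inv_SL2)
  then have "Y = act_diag (matrix_inv h ** g) X"
    by (simp add: act_diag_def vec_eq_iff)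
  moreover have "matrix_inv h ** g \<in> SL2"
    using g(1) h(1) by (simp add: SL2_mult matrix_inv_SL2)
  ultimately show ?thesis by (auto simp: group_orbit_def)
qed

section \<open>Conservation of the inner product\<close>

lemma bounded_bilinear_hinner: "bounded_bilinear hinner"
  unfolding bilinear_conv_bounded_bilinear[symmetric] bilinear_def hinner_def
  by (auto intro!: linearI simp: algebra_simps)

text \<open>The Lorentzian triple product with a repeated factor.\<close>

lemma hinner_scaleR_hcross:
  "hinner (a *\<^sub>R hcross u v) u = 0" "hinner u (a *\<^sub>R hcross u v) = 0"
  by (simp_all add: hinner_def hcross_def algebra_simps)

lemma hinner_vortex_field:
  "hinner (vortex_field \<Gamma> X $ 1) (X$2) = 0" "hinner (X$1) (vortex_field \<Gamma> X $ 2) = 0"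
proof -
  \<comment> \<open>The sum over the other vortices has one term, whose cross product has the other
    vortex as first factor.\<close>
  have "UNIV - {1::2} = {2}" "UNIV - {2::2} = {1}"
    by (auto simp: UNIV_2)
  then show "hinner (vortex_field \<Gamma> X $ 1) (X$2) = 0" "hinner (X$1) (vortex_field \<Gamma> X $ 2) = 0"
    by (simp_all add: vortex_field_def hinner_scaleR_hcross)
qed

lemma hinner_solution_on:
  assumes "solution_on \<Gamma> I x" and "s \<in> I" and "t \<in> I"
  shows "hinner (x s $ 1) (x s $ 2) = hinner (x t $ 1) (x t $ 2)"
proof -
  have "((\<lambda>t. hinner (x t $ 1) (x t $ 2)) has_vector_derivative 0) (at t within I)"
    if "t \<in> I" for t
  proof -
    have "(x has_vector_derivative vortex_field \<Gamma> (x t)) (at t within I)"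
      using assms(1) that by (auto simp: solution_on_def intro: has_vector_derivative_at_within)
    then have "((\<lambda>t. x t $ r) has_vector_derivative vortex_field \<Gamma> (x t) $ r) (at t within I)" for r
      by (rule bounded_linear.has_vector_derivative[OF bounded_linear_vec_nth])
    \<comment> \<open>Both terms of the product rule vanish.\<close>
    from bounded_bilinear.has_vector_derivative[OF bounded_bilinear_hinner this[of 1] this[of 2]]
    show ?thesis by (simp add: hinner_vortex_field)
  qed
  moreover have "convex I"
    using assms(1) by (simp add: solution_on_def is_interval_convex)
  ultimately obtain c where "\<And>t. t \<in> I \<Longrightarrow> hinner (x t $ 1) (x t $ 2) = c"
    using has_vector_derivative_zero_constant by blast
  then show ?thesis using assms(2,3) by simp
qed

text \<open>The two points may come from different solutions, so each is compared with the common
  initial value \<open>X\<close>.\<close>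

lemma trajectory_group_orbit:
  assumes "Y \<in> trajectory \<Gamma> X" and "Z \<in> trajectory \<Gamma> X"
  shows "Z \<in> group_orbit SL2 Y"
proof -
  have *: "W \<in> phase_space \<and> X \<in> phase_space \<and> hinner (X$1) (X$2) = hinner (W$1) (W$2)"
    if W: "W \<in> trajectory \<Gamma> X" for W
  proof -
    obtain x I t where "solution_on \<Gamma> I x" "0 \<in> I" "x 0 = X" "t \<in> I" "W = x t"
      using W by (auto simp: trajectory_def)
    then show ?thesis
      using hinner_solution_on[of \<Gamma> I x 0 t] by (auto simp: solution_on_def)
  qed
  show ?thesis
    using *[OF assms(1)] *[OF assms(2)] by (auto intro: group_orbit_if_same_hinner)
qed

theorem theorem8:
  fixes \<Gamma> :: "real^2"
  assumes "\<Gamma>$1 \<noteq> 0" and "\<Gamma>$2 \<noteq> 0"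
  shows "\<forall>X\<in>phase_space. relative_equilibrium \<Gamma> X \<and> group_stable SL2 \<Gamma> X"
proof (intro ballI conjI)
  fix X assume X: "X \<in> phase_space"
  have "Z \<in> group_orbit SL2 X" if Z: "Z \<in> trajectory \<Gamma> X" for Z
  proof -
    \<comment> \<open>The solution reaching \<open>Z\<close> takes the value \<open>X\<close> at
      time 0.\<close>
    have "X \<in> trajectory \<Gamma> X" using Z by (fastforce simp: trajectory_def)
    then show ?thesis using Z by (rule trajectory_group_orbit)
  qed
  with X show "relative_equilibrium \<Gamma> X"
    by (auto simp: relative_equilibrium_def)
  show "group_stable SL2 \<Gamma> X"
    unfolding group_stable_def
  proof (intro allI impI)
    fix V assume V: "invariant_nbhd SL2 X V"
    \<comment> \<open>\<open>V\<close> itself serves as \<open>U\<close>: a trajectory meeting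
      \<open>V\<close> at \<open>W\<close> lies in the orbit of \<open>W\<close>, which the
      invariant set \<open>V\<close> contains.\<close>
    have "trajectory \<Gamma> Y \<subseteq> V" if "trajectory \<Gamma> Y \<inter> V \<noteq> {}" for Y
    proof
      fix Z assume "Z \<in> trajectory \<Gamma> Y"
      with that obtain W where "W \<in> V" "Z \<in> group_orbit SL2 W"
        using trajectory_group_orbit by blast
      then show "Z \<in> V"
        using V by (auto simp: invariant_nbhd_def group_orbit_def)
    qed
    with V show "\<exists>U. invariant_nbhd SL2 X U \<and>
        (\<forall>Y\<in>phase_space. trajectory \<Gamma> Y \<inter> U \<noteq> {} \<longrightarrow> trajectory \<Gamma> Y \<subseteq> V)"
      by blast
  qed
qed

end
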